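(* Let $p$ be an odd prime, $N_{p-2}$ the number of permutations of $p-2$ letters with an even number of ascents, and $H'_{p-1}=1+\frac13+\dots+\frac1{p-2}$. Then the following are equivalent: (a) $p$ is a Wieferich prime; (b) $(2N_{p-2})_0=1$; (c) $(H'_{p-1})_0=0$.
   Context: A prime $p$ is a Wieferich prime if $q_p(2)=\frac{2^{p-1}-1}{p}\equiv0\pmod p$. For a $p$-adic integer $x$, $(x)_0\in\{0,\dots,p-1\}$ denotes its residue modulo $p$. For a permutation $(i_1,\dots,i_n)$ of $\{1,\dots,n\}$, an ascent is an index $k$ with $i_{k+1}>i_k$. *)

theory Defs
  imports
    Complex_Main
    "HOL-Computational_Algebra.Primes"
    "HOL-Number_Theory.Cong"
    "HOL-Combinatorics.Permutations"
begin

text \<open>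
  The ring of \<open>p\<close>-adic integers is represented by its subring of rational numbers, that is, by the
  rationals whose reduced denominator is prime to \<open>p\<close>; on this subring reduction modulo \<open>p\<close> of
  \<open>p\<close>-adic integers is congruence of rationals modulo \<open>p\<close>.
\<close>

definition p_integral :: "nat \<Rightarrow> rat \<Rightarrow> bool" where
  "p_integral p x \<longleftrightarrow> coprime (snd (quotient_of x)) (int p)"

definition p_cong :: "nat \<Rightarrow> rat \<Rightarrow> rat \<Rightarrow> bool" where
  "p_cong p x y \<longleftrightarrow> p_integral p ((x - y) / of_nat p)"

text \<open>
  The residue \<open>(x)\<^sub>0\<close>, meaningful for \<open>p\<close>-integral \<open>x\<close>; existence and uniqueness are shown below.
\<close>

definition p_residue :: "nat \<Rightarrow> rat \<Rightarrow> nat" where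
  "p_residue p x = (THE r. r < p \<and> p_cong p x (of_nat r))"

text \<open>
  The Fermat quotient is kept rational: truncating division would make \<open>2\<close> a Wieferich prime.
\<close>

definition fermat_quotient :: "nat \<Rightarrow> nat \<Rightarrow> rat" where
  "fermat_quotient p a = (of_nat a ^ (p - 1) - 1) / of_nat p"

definition wieferich_prime :: "nat \<Rightarrow> bool" where
  "wieferich_prime p \<longleftrightarrow> prime p \<and> p_cong p (fermat_quotient p 2) 0"

definition ascents :: "nat \<Rightarrow> (nat \<Rightarrow> nat) \<Rightarrow> nat set" where
  "ascents n f = {k \<in> {1..<n}. f (k + 1) > f k}"

definition even_ascent_perms :: "nat \<Rightarrow> nat" where
  "even_ascent_perms n = card {f. f permutes {1..n} \<and> even (card (ascents n f))}"

text \<open>\<open>H'\<^sub>m\<close>, the sum of the reciprocals of the odd numbers up to \<open>m\<close>.\<close>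

definition odd_harmonic :: "nat \<Rightarrow> rat" where
  "odd_harmonic m = (\<Sum>j \<in> {j \<in> {1..m}. odd j}. 1 / of_nat j)"

lemma p_integral_iff:
  "p_integral p x \<longleftrightarrow>
    (\<exists>a b. b \<noteq> 0 \<and> coprime b (int p) \<and> x = of_int a / of_int b)"
proof
  assume x: "p_integral p x"
  obtain n d where nd: "quotient_of x = (n, d)" by fastforce
  have "d > 0" "x = of_int n / of_int d"
    using quotient_of_denom_pos[OF nd] quotient_of_div[OF nd] by simp_all
  with x nd show "\<exists>a b. b \<noteq> 0 \<and> coprime b (int p) \<and> x = of_int a / of_int b"
    unfolding p_integral_def by (intro exI[of _ n] exI[of _ d]) simp
next
  assume "\<exists>a b. b \<noteq> 0 \<and> coprime b (int p) \<and> x = of_int a / of_int b"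
  then obtain a b where ab: "b \<noteq> 0" "coprime b (int p)" "x = of_int a / of_int b" by blast
  obtain n d where nd: "quotient_of x = (n, d)" by fastforce
  have d: "d > 0" "x = of_int n / of_int d" "coprime n d"
    using quotient_of_denom_pos[OF nd] quotient_of_div[OF nd] quotient_of_coprime[OF nd]
    by simp_all
  have "(of_int (n * b) :: rat) = of_int (a * d)"
    using ab d by (simp add: field_simps)
  hence "n * b = a * d" by (simp only: of_int_eq_iff)
  hence "d dvd n * b" by simp
  hence "d dvd b" using d(3) by (simp add: coprime_commute coprime_dvd_mult_right_iff)
  hence "coprime d (int p)" using ab(2) by (meson coprime_divisors dvd_refl)
  thus "p_integral p x" by (simp add: p_integral_def nd)
qed

lemma p_integral_of_int: "p_integral p (of_int a)"
  unfolding p_integral_iff by (intro exI[of _ a] exI[of _ 1]) simp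

lemma p_integral_add:
  assumes "p_integral p x" "p_integral p y"
  shows "p_integral p (x + y)"
proof -
  from assms obtain a b c d where
    ab: "b \<noteq> 0" "coprime b (int p)" "x = of_int a / of_int b" and
    cd: "d \<noteq> 0" "coprime d (int p)" "y = of_int c / of_int d"
    unfolding p_integral_iff by blast
  have "x + y = of_int (a * d + c * b) / of_int (b * d)"
    using ab cd by (simp add: field_simps)
  moreover have "b * d \<noteq> 0" "coprime (b * d) (int p)" using ab cd by simp_all
  ultimately show ?thesis unfolding p_integral_iff by blast
qed

lemma p_integral_minus:
  assumes "p_integral p x"
  shows "p_integral p (- x)"
proof -
  from assms obtain a b where
    "b \<noteq> 0" "coprime b (int p)" "x = of_int a / of_int b"
    unfolding p_integral_iff by blast
  thus ?thesis unfolding p_integral_iff by (intro exI[of _ "- a"] exI[of _ b]) simp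
qed

lemma p_cong_of_int_iff:
  assumes "p > 0"
  shows "p_cong p (of_int a) (of_int b) \<longleftrightarrow> [a = b] (mod int p)"
proof
  assume "p_cong p (of_int a) (of_int b)"
  then obtain c d where
    cd: "d \<noteq> 0" "coprime d (int p)" "(of_int a - of_int b) / of_nat p = (of_int c / of_int d :: rat)"
    unfolding p_cong_def p_integral_iff by blast
  have "(of_int ((a - b) * d) :: rat) = of_int (c * int p)"
    using cd assms by (simp add: field_simps)
  hence "(a - b) * d = c * int p" by (simp only: of_int_eq_iff)
  hence "int p dvd (a - b) * d" by simp
  hence "int p dvd a - b" using cd(2) by (simp add: coprime_commute coprime_dvd_mult_left_iff)
  thus "[a = b] (mod int p)" by (simp add: cong_iff_dvd_diff)
next
  assume "[a = b] (mod int p)"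
  then obtain k where k: "a - b = int p * k" by (auto simp: cong_iff_dvd_diff)
  have "(of_int a - of_int b :: rat) = of_int (int p * k)" by (simp flip: k)
  hence "(of_int a - of_int b) / of_nat p = (of_int k :: rat)" using assms by simp
  thus "p_cong p (of_int a) (of_int b)" by (simp add: p_cong_def p_integral_of_int)
qed

lemma p_residue_ex1:
  assumes "p > 0" "p_integral p x"
  shows "\<exists>!r. r < p \<and> p_cong p x (of_nat r)"
proof (rule ex_ex1I)
  from assms(2) obtain n d where
    nd: "d \<noteq> 0" "coprime d (int p)" "x = of_int n / of_int d"
    unfolding p_integral_iff by blast
  obtain y where y: "[d * y = 1] (mod int p)"
    using cong_solve_coprime_int[OF nd(2)] by blast
  define r where "r = nat ((n * y) mod int p)"
  have r: "int r = (n * y) mod int p" using assms(1) by (simp add: r_def)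
  have "int r < int p" unfolding r using assms(1) by (intro pos_mod_bound) simp
  hence "r < p" by simp
  have "[int r * d = (n * y) * d] (mod int p)"
    unfolding r by (intro cong_mult cong_refl) simp
  also have "(n * y) * d = n * (d * y)" by (simp add: ac_simps)
  also have "[n * (d * y) = n * 1] (mod int p)" by (intro cong_mult cong_refl y)
  finally obtain k where k: "n - int r * d = int p * k"
    by (metis cong_iff_dvd_diff cong_sym dvdE mult.right_neutral)
  have "(of_int n - of_nat r * of_int d :: rat) = of_int (n - int r * d)" by simp
  also have "\<dots> = of_nat p * of_int k" by (simp add: k)
  finally have "(x - of_nat r) / of_nat p = of_int k / of_int d"
    using nd(1) assms(1) by (simp add: nd(3) field_simps)
  hence "p_cong p x (of_nat r)"
    unfolding p_cong_def p_integral_iff using nd by blast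
  with \<open>r < p\<close> show "\<exists>r. r < p \<and> p_cong p x (of_nat r)" by blast
next
  fix r s
  assume r: "r < p \<and> p_cong p x (of_nat r)" and s: "s < p \<and> p_cong p x (of_nat s)"
  have "p_integral p ((x - of_nat s) / of_nat p + - ((x - of_nat r) / of_nat p))"
    using r s unfolding p_cong_def by (intro p_integral_add p_integral_minus) auto
  also have "(x - of_nat s) / of_nat p + - ((x - of_nat r) / of_nat p) =
      (of_int (int r) - of_int (int s)) / of_nat p"
    by (simp add: diff_divide_distrib)
  finally have "[int r = int s] (mod int p)"
    using p_cong_of_int_iff[OF assms(1)] unfolding p_cong_def by blast
  thus "r = s" using r s by (simp add: cong_int_iff cong_less_modulus_unique_nat)
qed

lemma p_residue_of_nat:
  assumes "p > 0"
  shows "p_residue p (of_nat n) = n mod p"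
proof -
  have "p_integral p (of_nat n)" using p_integral_of_int[of p "int n"] by simp
  moreover have "p_cong p (of_int (int n)) (of_int (int (n mod p)))"
    unfolding p_cong_of_int_iff[OF assms] cong_int_iff by (simp add: cong_def)
  ultimately show ?thesis
    unfolding p_residue_def using assms
    by (intro the1_equality p_residue_ex1) simp_all
qed

lemma p_integral_odd_harmonic:
  assumes "prime p" "m < p"
  shows "p_integral p (odd_harmonic m)"
proof -
  have *: "p_integral p (sum f A)" if "\<And>j. j \<in> A \<Longrightarrow> p_integral p (f j)"
    for f :: "nat \<Rightarrow> rat" and A
    using that p_integral_of_int[of p 0]
    by (induction A rule: infinite_finite_induct) (auto intro: p_integral_add)
  show ?thesis unfolding odd_harmonic_def
  proof (rule *)
    fix j assume j: "j \<in> {j \<in> {1..m}. odd j}"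
    hence "\<not> p dvd j" using assms(2) by (auto dest: dvd_imp_le)
    hence "coprime (int j) (int p)"
      using prime_imp_coprime[OF assms(1)] by (simp add: coprime_commute)
    thus "p_integral p (1 / of_nat j)"
      unfolding p_integral_iff using j by (intro exI[of _ 1] exI[of _ "int j"]) auto
  qed
qed

end

theory Submission
  imports
    Defs
    "HOL-Number_Theory.Residues"
    "HOL-Combinatorics.Multiset_Permutations"
begin

text \<open>
  All three conditions say that \<open>S = \<Sum> j\<^bsup>p-2\<^esup>\<close>, over the odd \<open>j \<le> p - 2\<close>, vanishes modulo \<open>p\<close>.
  Since \<open>j\<^bsup>p-2\<^esup>\<close> is the inverse of \<open>j\<close>, \<open>S\<close> is congruent to \<open>H'\<^bsub>p-1\<^esub>\<close>. The binomial coefficients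
  \<open>p choose j\<close> with \<open>j\<close> odd sum to \<open>2\<^bsup>p-1\<^esup>\<close>, and \<open>(p choose j) / p\<close> is congruent to \<open>1 / j\<close>,
  so the Fermat quotient of \<open>2\<close> is congruent to \<open>S\<close> as well. Finally, summing Worpitzky's identity
  \<open>\<Sum>\<^sub>\<sigma> (x + asc \<sigma>) choose n = x\<^sup>n\<close> for \<open>n = p - 2\<close> over the odd \<open>x \<le> p - 2\<close> gives
  \<open>S \<equiv> \<Sum>\<^sub>\<sigma> (-1)\<^bsup>asc \<sigma>\<^esup>\<close>, because modulo \<open>p\<close> the only nonzero coefficients involved are
  \<open>(p - 2) choose (p - 2) = 1\<close> and \<open>(p - 1) choose (p - 2) = -1\<close>; the signed sum equals
  \<open>2 N - (p - 2)!\<close>, where \<open>(p - 2)! \<equiv> 1\<close> by Wilson's theorem.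
\<close>

section \<open>Permutations as lists and Worpitzky's identity\<close>

text \<open>Ascents are counted on one-line notation because a new letter can be inserted into a
  list at any position.\<close>

fun list_ascents :: "'a :: linorder list \<Rightarrow> nat" where
  "list_ascents (x # y # zs) = of_bool (x < y) + list_ascents (y # zs)"
| "list_ascents _ = 0"

lemma list_ascents_less_length: "xs \<noteq> [] \<Longrightarrow> list_ascents xs < length xs"
  by (induction xs rule: list_ascents.induct) auto

lemma list_ascents_snoc:
  "list_ascents (xs @ [y]) = list_ascents xs + of_bool (xs \<noteq> [] \<and> last xs < y)"
  by (induction xs rule: list_ascents.induct) auto

lemma card_ascents_eq_list_ascents:
  "card (ascents n f) = list_ascents (map f [1..<Suc n])"
proof (induction n)
  case 0
  then show ?case by (simp add: ascents_def)
next
  case (Suc n)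
  \<comment> \<open>The letter at \<open>Suc n\<close> makes \<open>n\<close> the only new candidate
    index; for \<open>n = 0\<close> there is none, since indices start at 1.\<close>
  have "ascents (Suc n) f = (if n \<ge> 1 \<and> f n < f (Suc n) then insert n (ascents n f) else ascents n f)"
    by (auto simp: ascents_def less_Suc_eq)
  moreover have "finite (ascents n f)" "n \<notin> ascents n f"
    by (auto simp: ascents_def)
  ultimately have "card (ascents (Suc n) f) =
      card (ascents n f) + of_bool (n \<ge> 1 \<and> f n < f (Suc n))"
    by simp
  moreover have "map f [1..<Suc (Suc n)] = map f [1..<Suc n] @ [f (Suc n)]"
    by simp
  moreover have "map f [1..<Suc n] \<noteq> [] \<longleftrightarrow> n \<ge> 1"
    by auto
  moreover have "last (map f [1..<Suc n]) = f n" if "n \<ge> 1"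
    using that by (simp add: last_map)
  ultimately show ?case
    using Suc.IH list_ascents_snoc[of "map f [1..<Suc n]" "f (Suc n)"]
    by (cases "n \<ge> 1") (simp_all del: upt_Suc)
qed

text \<open>A permutation fixes everything outside \<open>{1..n}\<close>, so its list of values
  determines it. Both sets have \<open>n!\<close> elements, so injectivity suffices.\<close>

lemma bij_betw_permutes_permutations_of_set:
  "bij_betw (\<lambda>f. map f [1..<Suc n]) {f. f permutes {1..n}} (permutations_of_set {1..n})"
proof -
  let ?L = "\<lambda>f :: nat \<Rightarrow> nat. map f [1..<Suc n]"
  have inj: "inj_on ?L {f. f permutes {1..n}}"
  proof (rule inj_onI)
    fix f g assume fg: "f \<in> {f. f permutes {1..n}}" "g \<in> {f. f permutes {1..n}}" "?L f = ?L g"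
    show "f = g"
    proof
      fix x
      show "f x = g x"
      proof (cases "x \<in> {1..n}")
        case True
        then have "x \<in> set [1..<Suc n]" by auto
        then show ?thesis using fg(3) unfolding map_eq_conv by blast
      next
        case False
        then show ?thesis using fg by (auto simp: permutes_not_in)
      qed
    qed
  qed
  have "?L ` {f. f permutes {1..n}} \<subseteq> permutations_of_set {1..n}"
  proof safe
    fix f assume f: "f permutes {1..n}"
    have s: "set [1..<Suc n] = {1..n}" by auto
    show "?L f \<in> permutations_of_set {1..n}"
    proof
      show "set (?L f) = {1..n}"
        unfolding set_map s by (rule permutes_image[OF f])
      show "distinct (?L f)"
        unfolding distinct_map s using permutes_inj_on[OF f] by simp
    qed
  qed
  moreover have "card (?L ` {f. f permutes {1..n}}) = card (permutations_of_set {1..n})"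
    unfolding card_image[OF inj] by (simp add: card_permutations)
  ultimately show ?thesis
    unfolding bij_betw_def using inj card_subset_eq finite_permutations_of_set by blast
qed

section \<open>Insertion of a new letter\<close>

text \<open>Deleting \<open>m\<close> recovers the smaller list and the position, so insertion is
  injective; surjectivity follows by counting.\<close>

lemma sum_permutations_of_set_insert:
  assumes "finite A" "m \<notin> A"
  shows "(\<Sum>xs\<in>permutations_of_set (insert m A). g xs) =
    (\<Sum>xs\<in>permutations_of_set A. \<Sum>i\<le>length xs. g (take i xs @ m # drop i xs))"
proof -
  let ?S = "permutations_of_set A \<times> {..card A}"
  let ?I = "\<lambda>(xs, i). take i xs @ m # drop i xs"
  have len: "length xs = card A" if "xs \<in> permutations_of_set A" for xs
    using that by (rule length_finite_permutations_of_set)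
  have inj: "inj_on ?I ?S"
  proof (rule inj_onI, clarify)
    fix xs i ys j
    assume xs: "xs \<in> permutations_of_set A" and ys: "ys \<in> permutations_of_set A"
      and ij: "i \<le> card A" "j \<le> card A"
      and eq: "take i xs @ m # drop i xs = take j ys @ m # drop j ys"
    have "m \<notin> set xs" "m \<notin> set ys"
      using xs ys assms(2) by (auto dest: permutations_of_setD)
    then have "m \<notin> set (take i xs)" "m \<notin> set (drop i xs)"
      by (auto dest: in_set_takeD in_set_dropD)
    then have "take i xs = take j ys \<and> drop i xs = drop j ys"
      using eq append_Cons_eq_iff by metis
    then show "xs = ys \<and> i = j"
      using ij len[OF xs] len[OF ys] by (metis append_take_drop_id length_take min.absorb2)
  qed
  have "?I ` ?S \<subseteq> permutations_of_set (insert m A)"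
  proof safe
    fix xs i assume xs: "xs \<in> permutations_of_set A"
    have "mset (take i xs @ m # drop i xs) = mset (m # xs)"
      by (metis append_take_drop_id mset.simps(2) mset_append union_mset_add_mset_right)
    moreover have "distinct (m # xs)" "set (m # xs) = insert m A"
      using xs assms(2) by (auto dest: permutations_of_setD)
    ultimately show "take i xs @ m # drop i xs \<in> permutations_of_set (insert m A)"
      by (metis mset_eq_imp_distinct_iff mset_eq_setD permutations_of_setI)
  qed
  moreover have "card (?I ` ?S) = card (permutations_of_set (insert m A))"
    unfolding card_image[OF inj] using assms by (simp add: card_cartesian_product)
  ultimately have im: "?I ` ?S = permutations_of_set (insert m A)"
    by (meson card_subset_eq finite_permutations_of_set)
  have "(\<Sum>xs\<in>permutations_of_set (insert m A). g xs) = (\<Sum>z\<in>?S. g (?I z))"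
    unfolding im[symmetric] sum.reindex[OF inj] by simp
  also have "\<dots> = (\<Sum>xs\<in>permutations_of_set A. \<Sum>i\<le>card A. g (take i xs @ m # drop i xs))"
    by (simp add: sum.cartesian_product split_def)
  finally show ?thesis by (simp add: len)
qed

text \<open>
  A new maximum creates an ascent exactly when it is inserted at the end or at a descent.
\<close>

lemma sum_list_ascents_insert_Max_Cons:
  fixes g :: "nat \<Rightarrow> 'b :: comm_semiring_1"
  assumes "\<forall>y\<in>set (x # xs). y < m"
  shows "(\<Sum>i\<le>length xs. g (list_ascents (x # take i xs @ m # drop i xs))) =
    of_nat (list_ascents (x # xs)) * g (list_ascents (x # xs)) +
    of_nat (length (x # xs) - list_ascents (x # xs)) * g (Suc (list_ascents (x # xs)))"
  using assms
proof (induction xs arbitrary: x g)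
  case Nil
  then show ?case by simp
next
  case (Cons y ys)
  let ?a = "list_ascents (y # ys)" and ?b = "of_bool (x < y) :: nat"
  have m: "x < m" "\<not> m < y" using Cons.prems by auto
  have a: "?a \<le> length ys" using list_ascents_less_length[of "y # ys"] by simp
  \<comment> \<open>The term \<open>i = 0\<close> puts \<open>m\<close> between \<open>x\<close> and
    \<open>y\<close>: one ascent into \<open>m\<close>, none out of it, whether or not
    \<open>x < y\<close>.\<close>
  have "(\<Sum>i\<le>length (y # ys). g (list_ascents (x # take i (y # ys) @ m # drop i (y # ys)))) =
     g (Suc ?a) +
     (\<Sum>i\<le>length ys. g (?b + list_ascents (y # take i ys @ m # drop i ys)))"
    using m by (simp add: sum.atMost_Suc_shift del: sum.atMost_Suc)
  also have "(\<Sum>i\<le>length ys. g (?b + list_ascents (y # take i ys @ m # drop i ys))) =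
     of_nat ?a * g (?b + ?a) + of_nat (length (y # ys) - ?a) * g (?b + Suc ?a)"
    \<comment> \<open>The pair \<open>x\<close>, \<open>y\<close> now stays adjacent; its possible
      ascent is absorbed by shifting the argument of \<open>g\<close>.\<close>
    using Cons.IH[of y "\<lambda>k. g (?b + k)"] Cons.prems by simp
  finally show ?case
    using a by (simp add: Suc_diff_le algebra_simps)
qed

text \<open>The front position, now allowed too, adds no ascent and raises the first coefficient by
  one. These are the coefficients of the recurrence for Eulerian numbers.\<close>

lemma sum_list_ascents_insert_Max:
  fixes g :: "nat \<Rightarrow> 'b :: comm_semiring_1"
  assumes "\<forall>y\<in>set xs. y < m"
  shows "(\<Sum>i\<le>length xs. g (list_ascents (take i xs @ m # drop i xs))) =
    of_nat (Suc (list_ascents xs)) * g (list_ascents xs) +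
    of_nat (length xs - list_ascents xs) * g (Suc (list_ascents xs))"
proof (cases xs)
  case Nil
  then show ?thesis by simp
next
  case (Cons y ys)
  then have "\<not> m < y" using assms by auto
  then have "(\<Sum>i\<le>length xs. g (list_ascents (take i xs @ m # drop i xs))) =
      g (list_ascents xs) + (\<Sum>i\<le>length ys. g (list_ascents (y # take i ys @ m # drop i ys)))"
    unfolding Cons by (simp add: sum.atMost_Suc_shift del: sum.atMost_Suc)
  then show ?thesis
    using sum_list_ascents_insert_Max_Cons[of y ys m g] assms unfolding Cons
    by (simp add: algebra_simps)
qed

section \<open>Worpitzky's identity\<close>

text \<open>The weights \<open>Suc k\<close> and \<open>n - k\<close> count the insertions that keep
  \<open>k\<close> ascents or add one. Pascal's rule on the second binomial reduces the claim to
  absorption.\<close>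

lemma choose_Suc_absorb_add:
  fixes x k n :: nat
  assumes "k \<le> n"
  shows "Suc k * ((x + k) choose Suc n) + (n - k) * ((x + Suc k) choose Suc n) =
    x * ((x + k) choose n)"
proof -
  obtain d where d: "n = k + d" using assms le_Suc_ex by blast
  \<comment> \<open>This is \<open>(n + 1) (m choose (n + 1)) = (m - n) (m choose n)\<close> for
    \<open>m = x + k\<close>, written additively because \<open>m - n\<close> may truncate.\<close>
  have "Suc n * ((x + k) choose Suc n) + n * ((x + k) choose n) = (x + k) * ((x + k) choose n)"
  proof (cases "x + k")
    case 0
    then show ?thesis by (cases n) auto
  next
    case (Suc q)
    show ?thesis
    proof (cases n)
      case 0
      then show ?thesis by simp
    next
      case n: (Suc r)
      have "Suc n * ((x + k) choose Suc n) = (x + k) * (q choose n)"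
        unfolding Suc by (rule Suc_times_binomial)
      moreover have "n * ((x + k) choose n) = (x + k) * (q choose r)"
        unfolding Suc n by (rule Suc_times_binomial)
      moreover have "(x + k) choose n = (q choose r) + (q choose n)"
        unfolding Suc n by simp
      ultimately show ?thesis by (simp add: algebra_simps)
    qed
  qed
  then show ?thesis unfolding d by (simp add: algebra_simps)
qed

text \<open>The largest element is inserted last: for each list over the smaller set, summing over
  the insertion positions multiplies its term by \<open>x\<close>.\<close>

theorem worpitzky:
  fixes A :: "'a :: linorder set"
  assumes "finite A"
  shows "(\<Sum>xs\<in>permutations_of_set A. (x + list_ascents xs) choose card A) = x ^ card A"
  using assms
proof (induction A rule: finite_linorder_max_induct)
  case empty
  then show ?case by simp
next
  case (insert m A)
  then have m: "m \<notin> A" by auto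
  have "(\<Sum>i\<le>length xs. (x + list_ascents (take i xs @ m # drop i xs)) choose Suc (card A)) =
      x * ((x + list_ascents xs) choose card A)" if "xs \<in> permutations_of_set A" for xs
  proof -
    have xs: "set xs = A" "length xs = card A"
      using that by (auto dest: permutations_of_setD length_finite_permutations_of_set)
    have "list_ascents xs \<le> card A"
      using list_ascents_less_length[of xs] xs(2) by (cases "xs = []") auto
    then show ?thesis
      using sum_list_ascents_insert_Max[of xs m "\<lambda>k. (x + k) choose Suc (card A)"]
        insert.hyps(2) xs choose_Suc_absorb_add by simp
  qed
  then have "(\<Sum>xs\<in>permutations_of_set (insert m A). (x + list_ascents xs) choose Suc (card A)) =
      (\<Sum>xs\<in>permutations_of_set A. x * ((x + list_ascents xs) choose card A))"
    by (simp add: sum_permutations_of_set_insert insert.hyps(1) m)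
  then show ?case
    using insert m by (simp flip: sum_distrib_left)
qed

text \<open>Twice the indicator of an even \<open>a\<close> is \<open>1 + (-1) ^ a\<close>; the ones
  add up to \<open>n!\<close>.\<close>

lemma two_even_ascent_perms:
  "2 * int (even_ascent_perms n) =
     fact n + (\<Sum>xs\<in>permutations_of_set {1..n}. (-1) ^ list_ascents xs)"
proof -
  let ?P = "permutations_of_set {1..n}" and ?F = "{f. f permutes {1..n}}"
  have fin: "finite ?F" by (simp add: finite_permutations)
  have "2 * int (even_ascent_perms n) = (\<Sum>f\<in>?F. 2 * of_bool (even (card (ascents n f))))"
    unfolding even_ascent_perms_def sum_distrib_left[symmetric]
    using fin by (simp add: of_bool_def sum.If_cases Int_def)
  also have "\<dots> = (\<Sum>f\<in>?F. 1 + (-1) ^ card (ascents n f))"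
    by (intro sum.cong) auto
  also have "\<dots> = (\<Sum>xs\<in>?P. 1 + (-1) ^ list_ascents xs)"
    unfolding card_ascents_eq_list_ascents
    by (rule sum.reindex_bij_betw[OF bij_betw_permutes_permutations_of_set])
  finally show ?thesis
    by (simp add: sum.distrib)
qed

section \<open>Congruences modulo a prime\<close>

text \<open>The prime divides \<open>n!\<close> but neither \<open>k!\<close> nor
  \<open>(n - k)!\<close>, as both \<open>k\<close> and \<open>n - k\<close> are below
  \<open>p\<close>.\<close>

lemma prime_dvd_choose_if_less:
  fixes p :: nat
  assumes "prime p" "p \<le> n" "k < p" "n < p + k"
  shows "p dvd n choose k"
proof -
  have "k \<le> n" using assms by simp
  then have "p dvd fact k * fact (n - k) * (n choose k)"
    using assms by (simp add: binomial_fact_lemma prime_dvd_fact_iff)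
  then show ?thesis
    using assms by (auto simp: prime_dvd_mult_iff prime_dvd_fact_iff)
qed

text \<open>Neighbours in row \<open>p - 1\<close> of Pascal's triangle add up to an inner entry of
  row \<open>p\<close>, which vanishes modulo \<open>p\<close>, so the signs alternate from
  1.\<close>

lemma cong_prime_minus_1_choose:
  fixes p :: nat
  assumes "prime p" "k < p"
  shows "[int ((p - 1) choose k) = (-1) ^ k] (mod int p)"
  using assms(2)
proof (induction k)
  case 0
  then show ?case by simp
next
  case (Suc k)
  have "p dvd p choose Suc k"
    using assms Suc.prems by (intro prime_dvd_choose_if_less) auto
  moreover have "p choose Suc k = ((p - 1) choose k) + ((p - 1) choose Suc k)"
    using assms prime_gt_0_nat by (subst choose_reduce_nat) auto
  ultimately have "[int ((p - 1) choose k) + int ((p - 1) choose Suc k) = 0] (mod int p)"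
    unfolding cong_0_iff by (metis int_dvd_int_iff of_nat_add)
  from cong_diff[OF this Suc.IH] Suc.prems show ?case by simp
qed

lemma cong_choose_prime_minus_2:
  fixes p :: nat
  assumes p: "prime p" "m + 2 < 2 * p"
  shows "[int (m choose (p - 2)) = of_bool (m = p - 2) - of_bool (m = p - 1)] (mod int p)"
proof -
  have p2: "p \<ge> 2" using p(1) by (rule prime_ge_2_nat)
  consider "m < p - 2" | "m = p - 2" | "m = p - 1" | "m \<ge> p" by linarith
  then show ?thesis
  proof cases
    case 3
    have "(p - 1) choose (p - 2) = p - 1"
      using p2 binomial_symmetric[of "p - 2" "p - 1"] by simp
    then show ?thesis using 3 p2 by (simp add: cong_iff_dvd_diff of_nat_diff)
  next
    case 4
    then have "p dvd m choose (p - 2)"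
      using p p2 by (intro prime_dvd_choose_if_less) auto
    moreover have "m \<noteq> p - 2" "m \<noteq> p - 1" using 4 p2 by auto
    ultimately show ?thesis by (simp add: cong_0_iff)
  qed (use p2 in \<open>auto simp: binomial_eq_0\<close>)
qed

section \<open>The signed sum modulo \<open>p\<close>\<close>

text \<open>Only \<open>x = p - 2 - k\<close> (value 1) and \<open>x = p - 1 - k\<close> (value -1)
  can contribute. As \<open>p\<close> is odd, the first is odd for even \<open>k\<close> and the
  second for odd \<open>k\<close>, so exactly one is summed.\<close>

lemma sum_odd_choose_cong:
  fixes p :: nat
  assumes p: "prime p" "odd p" "k < p - 2"
  shows "[(\<Sum>x | x \<in> {1..p - 2} \<and> odd x. int ((x + k) choose (p - 2))) = (-1) ^ k] (mod int p)"
proof -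
  have p3: "p \<ge> 3" using p(3) by simp
  let ?X = "{x. x \<in> {1..p - 2} \<and> odd x}"
  have "[(\<Sum>x\<in>?X. int ((x + k) choose (p - 2))) =
      (\<Sum>x\<in>?X. of_bool (x + k = p - 2) - of_bool (x + k = p - 1))] (mod int p)"
    using p by (intro cong_sum cong_choose_prime_minus_2) auto
  also have "(\<Sum>x\<in>?X. of_bool (x + k = p - 2) - of_bool (x + k = p - 1)) =
      (\<Sum>x\<in>?X. (if x = p - 2 - k then 1 else 0) - (if x = p - 1 - k then 1 else 0 :: int))"
    using p p3 by (intro sum.cong arg_cong2[where f = "(-)"]) auto
  also have "\<dots> = of_bool (p - 2 - k \<in> ?X) - of_bool (p - 1 - k \<in> ?X)"
    unfolding sum_subtractf by (subst (1 2) sum.delta) auto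
  also have "\<dots> = (-1) ^ k"
    using p p3 by (cases "even k") (auto simp: elim!: oddE evenE)
  finally show ?thesis .
qed

lemma sum_sign_list_ascents_cong:
  fixes p :: nat
  assumes p: "prime p" "odd p"
  shows "[(\<Sum>xs\<in>permutations_of_set {1..p - 2}. (-1) ^ list_ascents xs) =
    (\<Sum>x | x \<in> {1..p - 2} \<and> odd x. int x ^ (p - 2))] (mod int p)"
proof -
  let ?P = "permutations_of_set {1..p - 2}" and ?X = "{x. x \<in> {1..p - 2} \<and> odd x}"
  have "p \<noteq> 2" using p(2) by auto
  then have p3: "p \<ge> 3" using prime_ge_2_nat[OF p(1)] by simp
  \<comment> \<open>The lists are nonempty because \<open>p \<ge> 3\<close>, so the strict bound
    required of \<open>k\<close> in \<open>sum_odd_choose_cong\<close> holds.\<close>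
  have "list_ascents xs < p - 2" if "xs \<in> ?P" for xs
  proof -
    have "length xs = p - 2" using length_finite_permutations_of_set[OF that] by simp
    then show ?thesis using p3 list_ascents_less_length[of xs] by (cases xs) simp_all
  qed
  then have "[(\<Sum>xs\<in>?P. (-1) ^ list_ascents xs) =
      (\<Sum>xs\<in>?P. \<Sum>x\<in>?X. int ((x + list_ascents xs) choose (p - 2)))] (mod int p)"
    using p by (intro cong_sum cong_sym[OF sum_odd_choose_cong]) auto
  also have "(\<Sum>xs\<in>?P. \<Sum>x\<in>?X. int ((x + list_ascents xs) choose (p - 2))) =
      (\<Sum>x\<in>?X. int (\<Sum>xs\<in>?P. (x + list_ascents xs) choose (p - 2)))"
    by (subst sum.swap) simp
  also have "\<dots> = (\<Sum>x\<in>?X. int x ^ (p - 2))"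
    using worpitzky[of "{1..p - 2}"] by simp
  finally show ?thesis .
qed

lemma fact_prime_minus_2_cong:
  fixes p :: nat
  assumes "prime p"
  shows "[fact (p - 2) = (1 :: int)] (mod int p)"
proof -
  have p2: "p \<ge> 2" using assms by (rule prime_ge_2_nat)
  then have "fact (p - 1) = (int p - 1) * fact (p - 2)"
    using fact_reduce[of "p - 1", where 'a = int] by (simp add: of_nat_diff numeral_2_eq_2)
  then have "[(int p - 1) * fact (p - 2) = - 1] (mod int p)"
    using wilson_theorem[OF assms] by simp
  \<comment> \<open>The difference on the right simplifies to
    \<open>fact (p - 2) - 1\<close>.\<close>
  then have "int p dvd int p * fact (p - 2) - ((int p - 1) * fact (p - 2) + 1)"
    by (intro dvd_diff) (auto simp: cong_iff_dvd_diff)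
  then show ?thesis by (simp add: cong_iff_dvd_diff algebra_simps)
qed

lemma prime_power_minus_2_inverse:
  fixes p j :: nat
  assumes "prime p" "0 < j" "j < p"
  shows "[int j * int j ^ (p - 2) = 1] (mod int p)"
proof -
  have "\<not> p dvd j" using assms by (auto dest: dvd_imp_le)
  then have "[int (j ^ (p - 1)) = int 1] (mod int p)"
    using fermat_theorem assms(1) cong_int_iff by blast
  moreover have "p - 1 = Suc (p - 2)"
    using prime_ge_2_nat[OF assms(1)] by simp
  ultimately show ?thesis by simp
qed

lemma cong_mult_inverse_power:
  fixes p j :: nat and a b :: int
  assumes "prime p" "0 < j" "j < p" "[int j * a = b] (mod int p)"
  shows "[a = b * int j ^ (p - 2)] (mod int p)"
proof -
  have "[a * (int j * int j ^ (p - 2)) = a * 1] (mod int p)"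
    using assms by (intro cong_mult cong_refl prime_power_minus_2_inverse)
  moreover have "[int j * a * int j ^ (p - 2) = b * int j ^ (p - 2)] (mod int p)"
    by (intro cong_mult assms cong_refl)
  ultimately show ?thesis
    by (metis cong_sym cong_trans mult.assoc mult.commute mult.right_neutral)
qed

section \<open>The Fermat quotient of 2\<close>

lemma fermat_quotient_2_eq:
  fixes p :: nat
  assumes p: "prime p" "odd p"
  shows "fermat_quotient p 2 =
    of_int (\<Sum>j | j \<in> {1..p - 2} \<and> odd j. int ((p choose j) div p))"
proof -
  let ?J = "{j. j \<in> {1..p - 2} \<and> odd j}"
  have "p \<noteq> 2" using p(2) by auto
  then have p3: "p \<ge> 3" using prime_ge_2_nat[OF p(1)] by simp
  \<comment> \<open>The index \<open>p\<close> is split off: its binomial is 1 and cancels the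
    \<open>- 1\<close> of the Fermat quotient, while \<open>p\<close> divides all the
    others.\<close>
  have "{j. j \<le> p \<and> odd j} = insert p ?J"
  proof (intro equalityI subsetI)
    fix j assume j: "j \<in> {j. j \<le> p \<and> odd j}"
    then have "j \<noteq> p - 1" "j > 0" using p p3 by (auto intro: odd_pos)
    then show "j \<in> insert p ?J" using j by auto
  qed (use p3 p in auto)
  moreover have "(\<Sum>j\<le>p. if odd j then int (p choose j) else 0) =
      (\<Sum>j | j \<le> p \<and> odd j. int (p choose j))"
    by (simp add: sum.If_cases Int_def)
  moreover have "(2 :: int) ^ p = 2 * 2 ^ (p - 1)"
    using p3 by (metis Suc_pred' less_le_trans power_Suc zero_less_numeral)
  moreover have "p \<notin> ?J" using p3 by auto
  ultimately have "2 ^ (p - 1) = 1 + (\<Sum>j\<in>?J. int (p choose j))"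
    using choose_odd_sum[of p, where 'a = int] p3 by simp
  also have "(\<Sum>j\<in>?J. int (p choose j)) = (\<Sum>j\<in>?J. int p * int ((p choose j) div p))"
  proof (intro sum.cong refl)
    fix j assume "j \<in> ?J"
    then have "p dvd p choose j"
      using p p3 by (intro prime_dvd_choose_if_less) auto
    then show "int (p choose j) = int p * int ((p choose j) div p)"
      by (metis dvd_mult_div_cancel of_nat_mult)
  qed
  finally have "(2 :: int) ^ (p - 1) - 1 = int p * (\<Sum>j\<in>?J. int ((p choose j) div p))"
    by (simp add: sum_distrib_left)
  then have "(of_int (2 ^ (p - 1) - 1) :: rat) =
      of_int (int p * (\<Sum>j\<in>?J. int ((p choose j) div p)))"
    by (rule arg_cong)
  then show ?thesis
    using p3 unfolding fermat_quotient_def by (simp add: field_simps)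
qed

text \<open>From \<open>j (p choose j) = p ((p - 1) choose (j - 1))\<close>, the product of
  \<open>j\<close> and the quotient is congruent to \<open>(-1) ^ (j - 1)\<close>, which is 1 for
  odd \<open>j\<close>.\<close>

lemma prime_choose_div_cong:
  fixes p :: nat
  assumes p: "prime p" "odd j" "j < p"
  shows "[int ((p choose j) div p) = int j ^ (p - 2)] (mod int p)"
proof -
  have j: "0 < j" using p(2) by (rule odd_pos)
  have "p dvd p choose j"
    using p j by (intro prime_dvd_choose_if_less) auto
  then have "p * (j * ((p choose j) div p)) = j * (p choose j)"
    by simp
  also have "\<dots> = p * ((p - 1) choose (j - 1))"
    using times_binomial_minus1_eq[OF j] .
  finally have "j * ((p choose j) div p) = (p - 1) choose (j - 1)"
    using p(3) by simp
  then have "[int j * int ((p choose j) div p) = (-1) ^ (j - 1)] (mod int p)"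
    using cong_prime_minus_1_choose[of p "j - 1"] p by (metis less_imp_diff_less of_nat_mult)
  then show ?thesis
    using cong_mult_inverse_power[OF p(1) j p(3), of _ 1] p(2) by simp
qed

lemma wieferich_prime_iff:
  fixes p :: nat
  assumes p: "prime p" "odd p"
  shows "wieferich_prime p \<longleftrightarrow>
    [(\<Sum>j | j \<in> {1..p - 2} \<and> odd j. int j ^ (p - 2)) = 0] (mod int p)"
proof -
  let ?J = "{j. j \<in> {1..p - 2} \<and> odd j}"
  have "[(\<Sum>j\<in>?J. int ((p choose j) div p)) = (\<Sum>j\<in>?J. int j ^ (p - 2))] (mod int p)"
    using p by (intro cong_sum prime_choose_div_cong) auto
  then have "[(\<Sum>j\<in>?J. int ((p choose j) div p)) = 0] (mod int p) \<longleftrightarrow>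
      [(\<Sum>j\<in>?J. int j ^ (p - 2)) = 0] (mod int p)"
    using cong_trans cong_sym by blast
  then show ?thesis
    unfolding wieferich_prime_def fermat_quotient_2_eq[OF p]
      p_cong_of_int_iff[OF prime_gt_0_nat[OF p(1)], of _ 0, unfolded of_int_0]
    using p(1) by blast
qed

section \<open>The odd harmonic sum\<close>

lemma p_cong_trans:
  assumes "p_cong p x y" "p_cong p y z"
  shows "p_cong p x z"
proof -
  have "p_integral p ((x - y) / of_nat p + (y - z) / of_nat p)"
    using assms unfolding p_cong_def by (rule p_integral_add)
  then show ?thesis by (simp add: p_cong_def diff_divide_distrib)
qed

lemma p_cong_sym: "p_cong p x y \<Longrightarrow> p_cong p y x"
  unfolding p_cong_def using p_integral_minus[of p "(x - y) / of_nat p"]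
  by (simp add: diff_divide_distrib)

lemma p_cong_sum:
  assumes "\<And>j. j \<in> A \<Longrightarrow> p_cong p (f j) (g j)"
  shows "p_cong p (sum f A) (sum g A)"
proof -
  have "p_integral p (\<Sum>j\<in>A. (f j - g j) / of_nat p)"
    using assms p_integral_of_int[of p 0]
    by (induction A rule: infinite_finite_induct) (auto intro: p_integral_add simp: p_cong_def)
  then show ?thesis
    by (simp add: p_cong_def sum_subtractf flip: sum_divide_distrib)
qed

lemma p_residue_eq_0_iff:
  assumes "p > 0" "p_integral p x"
  shows "p_residue p x = 0 \<longleftrightarrow> p_cong p x 0"
  unfolding p_residue_def
  using theI'[OF p_residue_ex1[OF assms]] the1_equality[OF p_residue_ex1[OF assms], of 0] assms(1)
  by auto

text \<open>The difference of the two sides is \<open>(1 - j * j ^ (p - 2)) / j\<close>: Fermat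
  makes the numerator a multiple of \<open>p\<close>, and \<open>j\<close> is prime to
  \<open>p\<close>.\<close>

lemma p_cong_inverse_power:
  assumes p: "prime p" and j: "0 < j" "j < p"
  shows "p_cong p (1 / of_nat j) (of_int (int j ^ (p - 2)))"
proof -
  obtain k where k: "1 - int j * int j ^ (p - 2) = int p * k"
    using prime_power_minus_2_inverse[OF p j] by (metis cong_iff_dvd_diff cong_sym dvdE)
  have "(1 - of_nat j * of_nat j ^ (p - 2) :: rat) = of_int (1 - int j * int j ^ (p - 2))"
    by simp
  also have "\<dots> = of_nat p * of_int k"
    unfolding k by simp
  also have "1 - of_nat j * of_nat j ^ (p - 2) =
      of_nat j * (1 / of_nat j - of_int (int j ^ (p - 2)) :: rat)"
    using j by (simp add: right_diff_distrib)
  finally have "(1 / of_nat j - of_int (int j ^ (p - 2))) / of_nat p = (of_int k / of_int (int j) :: rat)"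
    using j by (simp add: divide_simps mult.commute)
  moreover have "coprime (int j) (int p)"
    using p j prime_imp_coprime[of p j] dvd_imp_le[of p j]
    by (metis coprime_commute coprime_int_iff leD)
  ultimately show ?thesis
    unfolding p_cong_def p_integral_iff using j(1) by (metis of_nat_0_less_iff less_irrefl)
qed

lemma odd_harmonic_residue_iff:
  fixes p :: nat
  assumes p: "prime p" "odd p"
  shows "p_residue p (odd_harmonic (p - 1)) = 0 \<longleftrightarrow>
    [(\<Sum>j | j \<in> {1..p - 2} \<and> odd j. int j ^ (p - 2)) = 0] (mod int p)"
proof -
  let ?J = "{j. j \<in> {1..p - 2} \<and> odd j}"
  let ?S = "\<Sum>j\<in>?J. int j ^ (p - 2)"
  have p0: "p > 0" using p(1) by (rule prime_gt_0_nat)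
  \<comment> \<open>The upper end \<open>p - 1\<close> is even and drops out.\<close>
  have "{j \<in> {1..p - 1}. odd j} = ?J"
  proof (intro equalityI subsetI)
    fix j assume j: "j \<in> {j \<in> {1..p - 1}. odd j}"
    then have "j \<noteq> p - 1" using p by auto
    then show "j \<in> ?J" using j by auto
  qed auto
  then have "odd_harmonic (p - 1) = (\<Sum>j\<in>?J. 1 / of_nat j)"
    by (simp add: odd_harmonic_def)
  then have c: "p_cong p (odd_harmonic (p - 1)) (of_int ?S)"
    using p(1) by (auto intro!: p_cong_sum p_cong_inverse_power simp del: of_int_power simp: of_int_sum)
  have "p_residue p (odd_harmonic (p - 1)) = 0 \<longleftrightarrow> p_cong p (odd_harmonic (p - 1)) 0"
    using p p0 by (intro p_residue_eq_0_iff p_integral_odd_harmonic) auto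
  also have "\<dots> \<longleftrightarrow> p_cong p (of_int ?S) (of_int 0)"
    unfolding of_int_0 using p_cong_trans[OF c] p_cong_trans[OF p_cong_sym[OF c]] by blast
  also have "\<dots> \<longleftrightarrow> [?S = 0] (mod int p)"
    using p0 by (rule p_cong_of_int_iff)
  finally show ?thesis .
qed

section \<open>The residue of \<open>2 N\<close> and the equivalence\<close>

lemma even_ascent_perms_residue_iff:
  fixes p :: nat
  assumes p: "prime p" "odd p"
  shows "p_residue p (2 * of_nat (even_ascent_perms (p - 2))) = 1 \<longleftrightarrow>
    [(\<Sum>j | j \<in> {1..p - 2} \<and> odd j. int j ^ (p - 2)) = 0] (mod int p)"
proof -
  let ?S = "\<Sum>j | j \<in> {1..p - 2} \<and> odd j. int j ^ (p - 2)"
  let ?N = "2 * even_ascent_perms (p - 2)"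
  have p1: "p > 1" using p(1) by (rule prime_gt_1_nat)
  have "p_residue p (2 * of_nat (even_ascent_perms (p - 2))) = ?N mod p"
    using p_residue_of_nat[of p ?N] p1 by simp
  also have "?N mod p = 1 \<longleftrightarrow> [int ?N = 1] (mod int p)"
    using p1 cong_int_iff[of ?N 1 p] by (simp add: cong_def)
  also have "int ?N = fact (p - 2) +
      (\<Sum>xs\<in>permutations_of_set {1..p - 2}. (-1) ^ list_ascents xs)" (is "_ = ?R")
    using two_even_ascent_perms[of "p - 2"] by simp
  \<comment> \<open>By Wilson the factorial contributes 1 and the signed sum contributes
    \<open>?S\<close>, so \<open>2 N\<close> is congruent to \<open>1 + ?S\<close>.\<close>
  also have "[?R = 1] (mod int p) \<longleftrightarrow> [1 + ?S = 1 + 0] (mod int p)"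
  proof -
    have "[?R = 1 + ?S] (mod int p)"
      using fact_prime_minus_2_cong[OF p(1)] sum_sign_list_ascents_cong[OF p] by (rule cong_add)
    then show ?thesis
      unfolding add_0_right using cong_trans cong_sym by blast
  qed
  also have "\<dots> \<longleftrightarrow> [?S = 0] (mod int p)"
    by (rule cong_add_lcancel)
  finally show ?thesis .
qed

theorem theorem12:
  fixes p :: nat
  assumes "prime p" and "odd p"
  shows "(wieferich_prime p \<longleftrightarrow> p_residue p (2 * of_nat (even_ascent_perms (p - 2))) = 1) \<and>
         (p_residue p (2 * of_nat (even_ascent_perms (p - 2))) = 1 \<longleftrightarrow>
          p_residue p (odd_harmonic (p - 1)) = 0)"
  using wieferich_prime_iff[OF assms] even_ascent_perms_residue_iff[OF assms]
    odd_harmonic_residue_iff[OF assms] by blast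

end
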